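(* Let $R$ be an associative ring with unity, $\sigma\in End(R)$, and let $M_R$ be a $\sigma$-skew Armendariz right $R$-module which satisfies the condition $\mathcal{C}_2$. Then: (1) $M_R$ is a p.p.-module if and only if $M[x;\sigma]_{R[x;\sigma]}$ is a p.p.-module. (2) If $\sigma\in Aut(R)$, then $M_R$ is a p.p.-module if and only if $M[x,x^{-1};\sigma]_{R[x,x^{-1};\sigma]}$ is a p.p.-module.
   Context: Rings are associative with unity and modules are unitary right modules. $End(R)$ (respectively $Aut(R)$) is the set of ring endomorphisms $\sigma$ of $R$ with $\sigma(1)=1$ (respectively, ring automorphisms). A module $N_S$ (over any ring $S$) is called a p.p.-module if for every $n\in N$ there is an idempotent $e^2=e\in S$ with $r_S(n)=eS$, where $r_S(n)=\{a\in S: na=0\}$. $M_R$ satisfies $\mathcal{C}_2$ if for all $m\in M$, $a\in R$: $m\sigma(a)=0$ implies $ma=0$. $R[x;\sigma]$ is the skew polynomial ring (coefficients on the left, $xa=\sigma(a)x$). $M[x;\sigma]=\{\sum_{i=0}^s m_ix^i: s\ge 0, m_i\in M\}$ is a right $R[x;\sigma]$-module with the obvious addition and the scalar product $\left(\sum_{i} m_ix^i\right)\left(\sum_{j} a_jx^j\right)=\sum_{k}\left(\sum_{i+j=k}m_i\sigma^i(a_j)\right)x^k$. When $\sigma\in Aut(R)$, $R[x,x^{-1};\sigma]$ is the skew Laurent polynomial ring and $M[x,x^{-1};\sigma]=\{\sum_{i=-s}^t m_ix^i: s,t\ge 0, m_i\in M\}$ is a right $R[x,x^{-1};\sigma]$-module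 by the same formula for the scalar product (with indices ranging over integers). $M_R$ is $\sigma$-skew Armendariz if whenever $m(x)=\sum_{i=0}^n m_ix^i\in M[x;\sigma]$ and $f(x)=\sum_{j=0}^p a_jx^j\in R[x;\sigma]$ satisfy $m(x)f(x)=0$, then $m_i\sigma^i(a_j)=0$ for all $i$ and $j$. *)

theory Defs
  imports "HOL-Algebra.QuotRing"
begin

text \<open>
  Right modules over a (not necessarily commutative) ring, with the same record layout as the
  library's \<^verbatim>\<open>module\<close>: only the additive part of the inherited ring record is meaningful.
\<close>

record ('a, 'b) right_module = "'b ring" +
  rsmult :: "['b, 'a] \<Rightarrow> 'b" (infixl "\<cdot>\<index>" 70)

locale right_module = R?: ring R + M?: abelian_group M
  for R :: "('a, 'r) ring_scheme" (structure)
  and M :: "('a, 'b, 'm) right_module_scheme" (structure) +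
  assumes rsmult_closed [simp, intro]:
      "\<lbrakk>m \<in> carrier M; a \<in> carrier R\<rbrakk> \<Longrightarrow> m \<cdot>\<^bsub>M\<^esub> a \<in> carrier M"
    and rsmult_l_distr:
      "\<lbrakk>m \<in> carrier M; n \<in> carrier M; a \<in> carrier R\<rbrakk> \<Longrightarrow>
        (m \<oplus>\<^bsub>M\<^esub> n) \<cdot>\<^bsub>M\<^esub> a = m \<cdot>\<^bsub>M\<^esub> a \<oplus>\<^bsub>M\<^esub> n \<cdot>\<^bsub>M\<^esub> a"
    and rsmult_r_distr:
      "\<lbrakk>m \<in> carrier M; a \<in> carrier R; b \<in> carrier R\<rbrakk> \<Longrightarrow>
        m \<cdot>\<^bsub>M\<^esub> (a \<oplus>\<^bsub>R\<^esub> b) = m \<cdot>\<^bsub>M\<^esub> a \<oplus>\<^bsub>M\<^esub> m \<cdot>\<^bsub>M\<^esub> b"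
    and rsmult_assoc:
      "\<lbrakk>m \<in> carrier M; a \<in> carrier R; b \<in> carrier R\<rbrakk> \<Longrightarrow>
        m \<cdot>\<^bsub>M\<^esub> (a \<otimes>\<^bsub>R\<^esub> b) = (m \<cdot>\<^bsub>M\<^esub> a) \<cdot>\<^bsub>M\<^esub> b"
    and rsmult_one [simp]:
      "m \<in> carrier M \<Longrightarrow> m \<cdot>\<^bsub>M\<^esub> \<one>\<^bsub>R\<^esub> = m"

definition right_annihilator ::
    "('a, 'r) ring_scheme \<Rightarrow> ('a, 'b, 'm) right_module_scheme \<Rightarrow> 'b \<Rightarrow> 'a set" where
  "right_annihilator S N n = {a \<in> carrier S. n \<cdot>\<^bsub>N\<^esub> a = \<zero>\<^bsub>N\<^esub>}"

definition pp_module ::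
    "('a, 'r) ring_scheme \<Rightarrow> ('a, 'b, 'm) right_module_scheme \<Rightarrow> bool" where
  "pp_module S N \<longleftrightarrow>
    (\<forall>n \<in> carrier N. \<exists>e \<in> carrier S. e \<otimes>\<^bsub>S\<^esub> e = e \<and>
       right_annihilator S N n = {e \<otimes>\<^bsub>S\<^esub> a | a. a \<in> carrier S})"

definition condition_C2 ::
    "('a, 'r) ring_scheme \<Rightarrow> ('a \<Rightarrow> 'a) \<Rightarrow> ('a, 'b, 'm) right_module_scheme \<Rightarrow> bool" where
  "condition_C2 R \<sigma> M \<longleftrightarrow>
    (\<forall>m \<in> carrier M. \<forall>a \<in> carrier R. m \<cdot>\<^bsub>M\<^esub> \<sigma> a = \<zero>\<^bsub>M\<^esub> \<longrightarrow> m \<cdot>\<^bsub>M\<^esub> a = \<zero>\<^bsub>M\<^esub>)"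

text \<open>
  A (Laurent) polynomial is its coefficient function: a finitely supported function from the
  exponents (\<^typ>\<open>nat\<close>, respectively \<^typ>\<open>int\<close>) to the ring or module.
\<close>

definition fin_supp_funs :: "('b, 'm) ring_scheme \<Rightarrow> ('i \<Rightarrow> 'b) set" where
  "fin_supp_funs A = {f. (\<forall>i. f i \<in> carrier A) \<and> finite {i. f i \<noteq> \<zero>\<^bsub>A\<^esub>}}"

definition skew_poly_ring ::
    "('a, 'r) ring_scheme \<Rightarrow> ('a \<Rightarrow> 'a) \<Rightarrow> (nat \<Rightarrow> 'a) ring" where
  "skew_poly_ring R \<sigma> =
    \<lparr>carrier = fin_supp_funs R,
     mult = (\<lambda>f g k. \<Oplus>\<^bsub>R\<^esub>i\<in>{..k}. f i \<otimes>\<^bsub>R\<^esub> (\<sigma> ^^ i) (g (k - i))),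
     one = (\<lambda>i. if i = 0 then \<one>\<^bsub>R\<^esub> else \<zero>\<^bsub>R\<^esub>),
     zero = (\<lambda>i. \<zero>\<^bsub>R\<^esub>),
     add = (\<lambda>f g i. f i \<oplus>\<^bsub>R\<^esub> g i)\<rparr>"

definition skew_poly_module ::
    "('a, 'r) ring_scheme \<Rightarrow> ('a \<Rightarrow> 'a) \<Rightarrow> ('a, 'b, 'm) right_module_scheme \<Rightarrow>
      (nat \<Rightarrow> 'a, nat \<Rightarrow> 'b) right_module" where
  "skew_poly_module R \<sigma> M =
    \<lparr>carrier = fin_supp_funs M,
     mult = undefined,
     one = undefined,
     zero = (\<lambda>i. \<zero>\<^bsub>M\<^esub>),
     add = (\<lambda>m n i. m i \<oplus>\<^bsub>M\<^esub> n i),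
     rsmult = (\<lambda>m f k. \<Oplus>\<^bsub>M\<^esub>i\<in>{..k}. m i \<cdot>\<^bsub>M\<^esub> (\<sigma> ^^ i) (f (k - i)))\<rparr>"

definition skew_Armendariz ::
    "('a, 'r) ring_scheme \<Rightarrow> ('a \<Rightarrow> 'a) \<Rightarrow> ('a, 'b, 'm) right_module_scheme \<Rightarrow> bool" where
  "skew_Armendariz R \<sigma> M \<longleftrightarrow>
    (\<forall>m \<in> carrier (skew_poly_module R \<sigma> M). \<forall>f \<in> carrier (skew_poly_ring R \<sigma>).
       m \<cdot>\<^bsub>skew_poly_module R \<sigma> M\<^esub> f = \<zero>\<^bsub>skew_poly_module R \<sigma> M\<^esub> \<longrightarrow>
       (\<forall>i j. m i \<cdot>\<^bsub>M\<^esub> (\<sigma> ^^ i) (f j) = \<zero>\<^bsub>M\<^esub>))"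

text \<open>Integer powers of an automorphism; the inverse is taken on the carrier only.\<close>

definition aut_power ::
    "('a, 'r) ring_scheme \<Rightarrow> ('a \<Rightarrow> 'a) \<Rightarrow> int \<Rightarrow> 'a \<Rightarrow> 'a" where
  "aut_power R \<sigma> i =
    (if 0 \<le> i then \<sigma> ^^ nat i else inv_into (carrier R) \<sigma> ^^ nat (- i))"

text \<open>
  In the Laurent case infinitely many pairs of exponents add up to \<open>k\<close>; the sum runs over the
  finite support of the left factor, outside of which the summands vanish.
\<close>

definition skew_laurent_ring ::
    "('a, 'r) ring_scheme \<Rightarrow> ('a \<Rightarrow> 'a) \<Rightarrow> (int \<Rightarrow> 'a) ring" where
  "skew_laurent_ring R \<sigma> =
    \<lparr>carrier = fin_supp_funs R,
     mult = (\<lambda>f g k. \<Oplus>\<^bsub>R\<^esub>i\<in>{i. f i \<noteq> \<zero>\<^bsub>R\<^esub>}. f i \<otimes>\<^bsub>R\<^esub> aut_power R \<sigma> i (g (k - i))),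
     one = (\<lambda>i. if i = 0 then \<one>\<^bsub>R\<^esub> else \<zero>\<^bsub>R\<^esub>),
     zero = (\<lambda>i. \<zero>\<^bsub>R\<^esub>),
     add = (\<lambda>f g i. f i \<oplus>\<^bsub>R\<^esub> g i)\<rparr>"

definition skew_laurent_module ::
    "('a, 'r) ring_scheme \<Rightarrow> ('a \<Rightarrow> 'a) \<Rightarrow> ('a, 'b, 'm) right_module_scheme \<Rightarrow>
      (int \<Rightarrow> 'a, int \<Rightarrow> 'b) right_module" where
  "skew_laurent_module R \<sigma> M =
    \<lparr>carrier = fin_supp_funs M,
     mult = undefined,
     one = undefined,
     zero = (\<lambda>i. \<zero>\<^bsub>M\<^esub>),
     add = (\<lambda>m n i. m i \<oplus>\<^bsub>M\<^esub> n i),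
     rsmult = (\<lambda>m f k. \<Oplus>\<^bsub>M\<^esub>i\<in>{i. m i \<noteq> \<zero>\<^bsub>M\<^esub>}. m i \<cdot>\<^bsub>M\<^esub> aut_power R \<sigma> i (f (k - i)))\<rparr>"

end

theory Submission
  imports Defs
begin

text \<open>
  The Armendariz condition, applied to suitable linear polynomials, shows that for every idempotent
  \<open>e\<close> of \<open>R\<close> one has \<open>m\<sigma>(e) = me\<close> and \<open>mer = mre\<close> on \<open>M\<close>. Hence over a p.p.-module the common
  annihilator of finitely many elements is generated by a product of idempotents. For a (Laurent)
  polynomial \<open>m(x)\<close>, the Armendariz condition and \<open>C\<^sub>2\<close> identify \<open>r(m(x))\<close> with the (Laurent)
  polynomials whose coefficients annihilate every \<open>m\<^sub>i\<close>, so the idempotent generating the common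
  annihilator of the \<open>m\<^sub>i\<close> generates \<open>r(m(x))\<close>. For negative powers of \<open>\<sigma>\<close>, where \<open>C\<^sub>2\<close> points in the wrong
  direction, one uses that in a p.p.-module \<open>ma = 0\<close> implies \<open>m\<sigma>(a) = 0\<close>. Conversely, for a constant
  \<open>m\<close> with \<open>r(m) = e(x)R[x;\<sigma>]\<close>, the constant coefficient of \<open>e(x)\<close> generates \<open>r(m)\<close> in \<open>R\<close>.
\<close>

section \<open>Finite sums\<close>

lemma (in abelian_monoid) finsum_swap:
  assumes "finite A" "finite B" "\<And>i j. i \<in> A \<Longrightarrow> j \<in> B \<Longrightarrow> f i j \<in> carrier G"
  shows "(\<Oplus>i\<in>A. \<Oplus>j\<in>B. f i j) = (\<Oplus>j\<in>B. \<Oplus>i\<in>A. f i j)"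
  using assms(1,3)
proof (induction A rule: finite_induct)
  case (insert a A)
  have "(\<Oplus>i\<in>insert a A. \<Oplus>j\<in>B. f i j) = (\<Oplus>j\<in>B. f a j) \<oplus> (\<Oplus>j\<in>B. \<Oplus>i\<in>A. f i j)"
    using insert by (subst finsum_insert) (auto intro!: finsum_closed)
  also have "\<dots> = (\<Oplus>j\<in>B. f a j \<oplus> (\<Oplus>i\<in>A. f i j))"
    using insert.prems by (subst finsum_addf) (auto intro!: finsum_closed)
  also have "\<dots> = (\<Oplus>j\<in>B. \<Oplus>i\<in>insert a A. f i j)"
    using insert by (intro finsum_cong') (auto simp: finsum_insert intro!: finsum_closed)
  finally show ?case .
qed (simp add: finsum_zero)

lemma (in ring) finsum_ring_hom:
  assumes h: "h \<in> ring_hom R R" and f: "f \<in> A \<rightarrow> carrier R"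
  shows "h (\<Oplus>i\<in>A. f i) = (\<Oplus>i\<in>A. h (f i))"
  using f
proof (induction A rule: infinite_finite_induct)
  case (insert a A)
  then have "h (\<Oplus>i\<in>insert a A. f i) = h (f a \<oplus> (\<Oplus>i\<in>A. f i))"
    by (subst finsum_insert) (auto simp: Pi_def)
  also have "\<dots> = h (f a) \<oplus> (\<Oplus>i\<in>A. h (f i))"
    using insert ring_hom_add[OF h] by (simp add: Pi_def finsum_closed)
  also have "\<dots> = (\<Oplus>i\<in>insert a A. h (f i))"
    using insert ring_hom_closed[OF h] by (subst finsum_insert) (auto simp: Pi_def)
  finally show ?case .
\<comment> \<open>Empty and infinite index sets: a sum over an infinite set is zero by default, so
  both cases reduce to \<open>h\<close> preserving zero.\<close>
qed (use ring_hom_zero[OF h ring_axioms ring_axioms] in \<open>auto simp: finsum_infinite\<close>)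

section \<open>Powers of the twist\<close>

lemma (in ring) ring_hom_funpow:
  assumes "\<sigma> \<in> ring_hom R R"
  shows "\<sigma> ^^ n \<in> ring_hom R R"
proof (induction n)
  case (Suc n)
  then show ?case
    using ring_hom_trans[OF _ assms] by (simp add: comp_def)
qed (simp add: ring_hom_def)

locale ring_automorphism = R?: ring R for R :: "('a, 'r) ring_scheme" (structure) +
  fixes \<sigma> :: "'a \<Rightarrow> 'a"
  assumes iso: "\<sigma> \<in> ring_iso R R"
begin

text \<open>The inverse taken on the carrier is again an isomorphism, so negative powers too are
  iterated endomorphisms.\<close>

lemma aut_power_hom: "aut_power R \<sigma> i \<in> ring_hom R R"
  using iso ring_iso_set_sym[OF ring_axioms iso]
  by (auto simp: aut_power_def ring_iso_def intro!: ring_hom_funpow)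

lemmas aut_power_closed [simp] = ring_hom_closed[OF aut_power_hom]
  and aut_power_mult = ring_hom_mult[OF aut_power_hom]
  and aut_power_zero [simp] = ring_hom_zero[OF aut_power_hom ring_axioms ring_axioms]

lemma aut_power_0 [simp]: "aut_power R \<sigma> 0 a = a"
  by (simp add: aut_power_def)

lemma aut_power_of_nat: "aut_power R \<sigma> (int n) = \<sigma> ^^ n"
  by (simp add: aut_power_def)

lemma inj: "inj_on \<sigma> (carrier R)" and surj: "\<sigma> ` carrier R = carrier R"
  using iso by (auto simp: ring_iso_def bij_betw_def)

lemma aut_power_succ:
  assumes a: "a \<in> carrier R"
  shows "aut_power R \<sigma> (i + 1) a = \<sigma> (aut_power R \<sigma> i a)"
proof (cases "0 \<le> i")
  case True
  then show ?thesis
    by (simp add: aut_power_def nat_add_distrib)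
next
  case False
  \<comment> \<open>\<open>n\<close> is chosen with \<open>i + 1 = - n\<close>, so the power at
    \<open>i\<close> applies the inverse once more than the power at \<open>i + 1\<close>; the
    border case \<open>i = -1\<close> is \<open>n = 0\<close>.\<close>
  define n where "n = nat (- (i + 1))"
  have i: "i = - 1 - int n"
    using False by (simp add: n_def)
  define b where "b = aut_power R \<sigma> (i + 1) a"
  have b: "b \<in> carrier R" "b = (inv_into (carrier R) \<sigma> ^^ n) a"
    using a by (auto simp: b_def i) (auto simp: aut_power_def)
  have "aut_power R \<sigma> i a = inv_into (carrier R) \<sigma> b"
    using i by (simp add: aut_power_def b(2) nat_add_distrib)
  then show ?thesis
    using b surj by (simp add: f_inv_into_f flip: b_def)
qed

lemma aut_power_add:
  assumes a: "a \<in> carrier R"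
  shows "aut_power R \<sigma> (i + j) a = aut_power R \<sigma> i (aut_power R \<sigma> j a)"
proof (induction i rule: int_induct[where k = 0])
  case (step1 i)
  then show ?case
    using a aut_power_succ[of a "i + j"] aut_power_succ[of "aut_power R \<sigma> j a" i]
    by (simp add: algebra_simps)
next
  case (step2 i)
  \<comment> \<open>Downward step: after applying \<open>\<sigma>\<close> both sides agree by the
    induction hypothesis, and injectivity cancels it.\<close>
  have "\<sigma> (aut_power R \<sigma> (i - 1 + j) a) = \<sigma> (aut_power R \<sigma> (i - 1) (aut_power R \<sigma> j a))"
    using a step2 aut_power_succ[of a "i - 1 + j"] aut_power_succ[of "aut_power R \<sigma> j a" "i - 1"]
    by (simp add: algebra_simps)
  then show ?case
    using inj a by (auto dest: inj_onD)
qed simp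

section \<open>Multiplication of skew Laurent polynomials\<close>

text \<open>Summands outside the support of \<open>f\<close> vanish. Enlarging the range lets sums
  with different left factors be compared, and keeps a chosen index available even when its
  coefficient is zero.\<close>

lemma mult_skew_laurent_widen:
  assumes f: "f \<in> fin_supp_funs R" and g: "g \<in> fin_supp_funs R"
    and A: "finite A" "{i. f i \<noteq> \<zero>} \<subseteq> A"
  shows "(f \<otimes>\<^bsub>skew_laurent_ring R \<sigma>\<^esub> g) k = (\<Oplus>i\<in>A. f i \<otimes> aut_power R \<sigma> i (g (k - i)))"
proof -
  have "(\<Oplus>i\<in>{i. f i \<noteq> \<zero>}. f i \<otimes> aut_power R \<sigma> i (g (k - i))) =
      (\<Oplus>i\<in>A. f i \<otimes> aut_power R \<sigma> i (g (k - i)))"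
    using A f g by (intro add.finprod_mono_neutral_cong_left) (auto simp: fin_supp_funs_def)
  then show ?thesis
    by (simp add: skew_laurent_ring_def)
qed

text \<open>A nonzero coefficient at \<open>k\<close> forces \<open>k = i + j\<close> with
  \<open>i\<close> and \<open>j\<close> in the two supports, which leaves finitely many
  \<open>k\<close>.\<close>

lemma mult_skew_laurent_fin_supp:
  assumes f: "f \<in> fin_supp_funs R" and g: "g \<in> fin_supp_funs R"
  shows "f \<otimes>\<^bsub>skew_laurent_ring R \<sigma>\<^esub> g \<in> fin_supp_funs R"
proof -
  let ?A = "{i. f i \<noteq> \<zero>}" and ?B = "{i. g i \<noteq> \<zero>}"
  have fin: "finite ?A" "finite ?B"
    using f g by (auto simp: fin_supp_funs_def)
  have "(f \<otimes>\<^bsub>skew_laurent_ring R \<sigma>\<^esub> g) k = \<zero>" if "k \<notin> (\<lambda>(i, j). i + j) ` (?A \<times> ?B)" for k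
  proof -
    have "g (k - i) = \<zero>" if "i \<in> ?A" for i
      using that \<open>k \<notin> _\<close> by (force simp: image_iff)
    then show ?thesis
      using f by (auto simp: skew_laurent_ring_def fin_supp_funs_def intro!: add.finprod_one_eqI)
  qed
  then have "{k. (f \<otimes>\<^bsub>skew_laurent_ring R \<sigma>\<^esub> g) k \<noteq> \<zero>} \<subseteq> (\<lambda>(i, j). i + j) ` (?A \<times> ?B)"
    by blast
  then have "finite {k. (f \<otimes>\<^bsub>skew_laurent_ring R \<sigma>\<^esub> g) k \<noteq> \<zero>}"
    by (rule finite_subset) (use fin in simp)
  moreover have "(f \<otimes>\<^bsub>skew_laurent_ring R \<sigma>\<^esub> g) k \<in> carrier R" for k
    using f g by (auto simp: skew_laurent_ring_def fin_supp_funs_def intro!: finsum_closed)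
  ultimately show ?thesis
    by (simp add: fin_supp_funs_def)
qed

text \<open>Both sides expand to one sum over pairs \<open>(i, j)\<close> from the supports of
  \<open>f\<close> and \<open>g\<close>, and additivity of the powers of \<open>\<sigma>\<close>
  matches the twists. This is what later shows that an idempotent Laurent polynomial fixes the right
  ideal it generates.\<close>

lemma mult_skew_laurent_assoc:
  assumes f: "f \<in> fin_supp_funs R" and g: "g \<in> fin_supp_funs R" and h: "h \<in> fin_supp_funs R"
  shows "(f \<otimes>\<^bsub>skew_laurent_ring R \<sigma>\<^esub> g) \<otimes>\<^bsub>skew_laurent_ring R \<sigma>\<^esub> h =
    f \<otimes>\<^bsub>skew_laurent_ring R \<sigma>\<^esub> (g \<otimes>\<^bsub>skew_laurent_ring R \<sigma>\<^esub> h)" (is "?L = ?R")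
proof
  fix k
  define A where "A = {i. f i \<noteq> \<zero>}"
  define B where "B = {i. g i \<noteq> \<zero>}"
  \<comment> \<open>\<open>C\<close> contains the support of the inner product, as widening
    requires, and every shift of \<open>B\<close> by an element of \<open>A\<close>, as the
    substitution \<open>l = i + j\<close> requires.\<close>
  define C where "C = {i. (f \<otimes>\<^bsub>skew_laurent_ring R \<sigma>\<^esub> g) i \<noteq> \<zero>} \<union> (\<lambda>(i, j). i + j) ` (A \<times> B)"
  note fg = mult_skew_laurent_fin_supp[OF f g] and gh = mult_skew_laurent_fin_supp[OF g h]
  have fin: "finite A" "finite B" "finite C"
    using f g fg by (auto simp: fin_supp_funs_def A_def B_def C_def)
  have [simp]: "f i \<in> carrier R" "g i \<in> carrier R" "h i \<in> carrier R" for i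
    using f g h by (auto simp: fin_supp_funs_def)
  let ?s = "aut_power R \<sigma>"
  have "?L k = (\<Oplus>l\<in>C. (\<Oplus>i\<in>A. f i \<otimes> ?s i (g (l - i))) \<otimes> ?s l (h (k - l)))"
    by (subst mult_skew_laurent_widen[OF fg h \<open>finite C\<close>])
      (auto simp: C_def A_def skew_laurent_ring_def)
  also have "\<dots> = (\<Oplus>l\<in>C. \<Oplus>i\<in>A. f i \<otimes> ?s i (g (l - i)) \<otimes> ?s l (h (k - l)))"
    using fin by (intro finsum_cong') (auto simp: finsum_ldistr intro!: finsum_closed)
  also have "\<dots> = (\<Oplus>i\<in>A. \<Oplus>l\<in>C. f i \<otimes> ?s i (g (l - i)) \<otimes> ?s l (h (k - l)))"
    using fin by (intro finsum_swap) auto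
  also have "\<dots> = (\<Oplus>i\<in>A. f i \<otimes> ?s i ((g \<otimes>\<^bsub>skew_laurent_ring R \<sigma>\<^esub> h) (k - i)))"
  proof (intro finsum_cong' refl)
    fix i assume i: "i \<in> A"
    have "(\<Oplus>l\<in>C. f i \<otimes> ?s i (g (l - i)) \<otimes> ?s l (h (k - l))) =
        (\<Oplus>l\<in>(\<lambda>j. i + j) ` B. f i \<otimes> ?s i (g (l - i)) \<otimes> ?s l (h (k - l)))"
    proof (rule add.finprod_mono_neutral_cong_right)
      show "f i \<otimes> ?s i (g (l - i)) \<otimes> ?s l (h (k - l)) = \<zero>" if "l \<in> C - (\<lambda>j. i + j) ` B" for l
      proof -
        have "g (l - i) = \<zero>"
          using that by (force simp: B_def image_iff)
        then show ?thesis by simp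
      qed
      show "(\<lambda>j. i + j) ` B \<subseteq> C"
        using i by (auto simp: C_def)
    qed (use fin in auto)
    also have "\<dots> = (\<Oplus>j\<in>B. f i \<otimes> ?s i (g j) \<otimes> ?s (i + j) (h (k - i - j)))"
      by (subst finsum_reindex) (auto simp: diff_diff_eq)
    also have "\<dots> = (\<Oplus>j\<in>B. f i \<otimes> ?s i (g j \<otimes> ?s j (h (k - i - j))))"
      by (intro finsum_cong') (auto simp: aut_power_mult aut_power_add m_assoc)
    also have "\<dots> = f i \<otimes> (\<Oplus>j\<in>B. ?s i (g j \<otimes> ?s j (h (k - i - j))))"
      using fin by (subst finsum_rdistr) auto
    also have "\<dots> = f i \<otimes> ?s i (\<Oplus>j\<in>B. g j \<otimes> ?s j (h (k - i - j)))"
      by (subst finsum_ring_hom[OF aut_power_hom]) auto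
    also have "\<dots> = f i \<otimes> ?s i ((g \<otimes>\<^bsub>skew_laurent_ring R \<sigma>\<^esub> h) (k - i))"
      by (simp add: skew_laurent_ring_def B_def)
    finally show "(\<Oplus>l\<in>C. f i \<otimes> ?s i (g (l - i)) \<otimes> ?s l (h (k - l))) =
      f i \<otimes> ?s i ((g \<otimes>\<^bsub>skew_laurent_ring R \<sigma>\<^esub> h) (k - i))" .
  qed (use gh in \<open>auto simp: fin_supp_funs_def\<close>)
  also have "\<dots> = ?R k"
    by (subst (2) skew_laurent_ring_def) (simp add: A_def)
  finally show "?L k = ?R k" .
qed

end

section \<open>Annihilators and idempotents\<close>

context right_module
begin

lemma rsmult_zero_right [simp]:
  assumes "m \<in> carrier M"
  shows "m \<cdot>\<^bsub>M\<^esub> \<zero> = \<zero>\<^bsub>M\<^esub>"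
proof -
  have "m \<cdot>\<^bsub>M\<^esub> \<zero> \<oplus>\<^bsub>M\<^esub> m \<cdot>\<^bsub>M\<^esub> \<zero> = m \<cdot>\<^bsub>M\<^esub> \<zero>"
    using assms by (simp flip: rsmult_r_distr)
  then show ?thesis
    using assms by (metis M.add.l_cancel_one' R.zero_closed rsmult_closed)
qed

lemma rsmult_zero_left [simp]:
  assumes "a \<in> carrier R"
  shows "\<zero>\<^bsub>M\<^esub> \<cdot>\<^bsub>M\<^esub> a = \<zero>\<^bsub>M\<^esub>"
proof -
  have "\<zero>\<^bsub>M\<^esub> \<cdot>\<^bsub>M\<^esub> a \<oplus>\<^bsub>M\<^esub> \<zero>\<^bsub>M\<^esub> \<cdot>\<^bsub>M\<^esub> a = \<zero>\<^bsub>M\<^esub> \<cdot>\<^bsub>M\<^esub> a"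
    using assms by (simp flip: rsmult_l_distr)
  then show ?thesis
    using assms by (metis M.add.l_cancel_one' M.zero_closed rsmult_closed)
qed

lemma rsmult_minus_right:
  assumes "m \<in> carrier M" "a \<in> carrier R"
  shows "m \<cdot>\<^bsub>M\<^esub> (\<ominus> a) = \<ominus>\<^bsub>M\<^esub> (m \<cdot>\<^bsub>M\<^esub> a)"
proof -
  have "m \<cdot>\<^bsub>M\<^esub> (\<ominus> a) \<oplus>\<^bsub>M\<^esub> m \<cdot>\<^bsub>M\<^esub> a = \<zero>\<^bsub>M\<^esub>"
    using assms by (simp add: R.l_neg flip: rsmult_r_distr)
  then show ?thesis
    using assms by (simp add: M.minus_equality)
qed

text \<open>For an idempotent \<open>e\<close>, the right ideal \<open>eR\<close> consists of the
  elements fixed by left multiplication with \<open>e\<close>; an equality of sets thus becomes a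
  pointwise test.\<close>

lemma pp_module_iff:
  "pp_module R M \<longleftrightarrow>
    (\<forall>m\<in>carrier M. \<exists>e\<in>carrier R. e \<otimes> e = e \<and> (\<forall>a\<in>carrier R. m \<cdot>\<^bsub>M\<^esub> a = \<zero>\<^bsub>M\<^esub> \<longleftrightarrow> e \<otimes> a = a))"
proof -
  have "right_annihilator R M m = {e \<otimes> a | a. a \<in> carrier R} \<longleftrightarrow>
      (\<forall>a\<in>carrier R. m \<cdot>\<^bsub>M\<^esub> a = \<zero>\<^bsub>M\<^esub> \<longleftrightarrow> e \<otimes> a = a)"
    if e: "e \<in> carrier R" "e \<otimes> e = e" for m e
  proof -
    have "{e \<otimes> a | a. a \<in> carrier R} = {a \<in> carrier R. e \<otimes> a = a}"
      using e by (force simp flip: m_assoc)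
    then show ?thesis
      unfolding right_annihilator_def by blast
  qed
  then show ?thesis
    unfolding pp_module_def by (intro ball_cong bex_cong conj_cong refl) simp
qed

text \<open>Induction on \<open>F\<close>: if \<open>e\<close> generates the annihilator of
  \<open>F\<close> and \<open>f\<close> that of \<open>n\<close>, then \<open>ef\<close> generates
  their intersection. The hypothesis \<open>comm\<close> puts \<open>ef\<close> into the annihilator
  of \<open>n\<close>; \<open>rsmult_idempotent_commute\<close> supplies it later.\<close>

lemma pp_module_finite_annihilator:
  assumes pp: "pp_module R M"
    and comm: "\<And>m e r. m \<in> carrier M \<Longrightarrow> e \<in> carrier R \<Longrightarrow> e \<otimes> e = e \<Longrightarrow> r \<in> carrier R \<Longrightarrow>
      m \<cdot>\<^bsub>M\<^esub> (e \<otimes> r) = m \<cdot>\<^bsub>M\<^esub> (r \<otimes> e)"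
    and F: "finite F" "F \<subseteq> carrier M"
  shows "\<exists>e\<in>carrier R. e \<otimes> e = e \<and> (\<forall>a\<in>carrier R. (\<forall>m\<in>F. m \<cdot>\<^bsub>M\<^esub> a = \<zero>\<^bsub>M\<^esub>) \<longleftrightarrow> e \<otimes> a = a)"
  using F
proof (induction F rule: finite_induct)
  case empty
  then show ?case
    by (intro bexI[where x = \<one>]) auto
next
  case (insert n F)
  then obtain e where e: "e \<in> carrier R" "e \<otimes> e = e"
    and eF: "\<And>a. a \<in> carrier R \<Longrightarrow> (\<forall>m\<in>F. m \<cdot>\<^bsub>M\<^esub> a = \<zero>\<^bsub>M\<^esub>) \<longleftrightarrow> e \<otimes> a = a"
    by auto
  have n: "n \<in> carrier M"
    using insert by simp
  then obtain f where f: "f \<in> carrier R" "f \<otimes> f = f"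
    and fn: "\<And>a. a \<in> carrier R \<Longrightarrow> n \<cdot>\<^bsub>M\<^esub> a = \<zero>\<^bsub>M\<^esub> \<longleftrightarrow> f \<otimes> a = a"
    using pp unfolding pp_module_iff by blast
  \<comment> \<open>Idempotents need not commute in \<open>R\<close>, only on \<open>M\<close>; still \<open>ef\<close> lies in \<open>r(n) = fR\<close>, so \<open>fef = ef\<close>.\<close>
  have "n \<cdot>\<^bsub>M\<^esub> (e \<otimes> f) = (n \<cdot>\<^bsub>M\<^esub> f) \<cdot>\<^bsub>M\<^esub> e"
    using comm[OF n e f(1)] n e f by (simp add: rsmult_assoc)
  also have "\<dots> = \<zero>\<^bsub>M\<^esub>"
    using fn[of f] f e by simp
  finally have fef: "f \<otimes> (e \<otimes> f) = e \<otimes> f"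
    using fn e f by simp
  have idem: "(e \<otimes> f) \<otimes> (e \<otimes> f) = e \<otimes> f"
    using fef e f by (metis m_assoc m_closed)
  have "(\<forall>m\<in>insert n F. m \<cdot>\<^bsub>M\<^esub> a = \<zero>\<^bsub>M\<^esub>) \<longleftrightarrow> (e \<otimes> f) \<otimes> a = a" if a: "a \<in> carrier R" for a
  proof -
    \<comment> \<open>From \<open>efa = a\<close> follow \<open>ea = eefa = a\<close> and, since
      \<open>fef = ef\<close>, also \<open>fa = fefa = a\<close>.\<close>
    have "f \<otimes> a = a \<and> e \<otimes> a = a \<longleftrightarrow> (e \<otimes> f) \<otimes> a = a"
      using a e f fef by (metis m_assoc m_closed)
    then show ?thesis
      using eF[OF a] fn[OF a] by simp
  qed
  then show ?case
    using idem e f by (intro bexI[where x = "e \<otimes> f"]) auto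
qed

end

section \<open>Skew Armendariz modules\<close>

locale skew_Armendariz_module = right_module R M
  for R :: "('a, 'r) ring_scheme" (structure)
  and M :: "('a, 'b, 'm) right_module_scheme" (structure) +
  fixes \<sigma> :: "'a \<Rightarrow> 'a"
  assumes hom: "\<sigma> \<in> ring_hom R R"
    and Armendariz: "skew_Armendariz R \<sigma> M"
begin

lemmas funpow_hom = ring_hom_funpow[OF hom]
lemmas twist_closed [simp] = ring_hom_closed[OF hom]
  and twist_mult = ring_hom_mult[OF hom]
  and twist_zero [simp] = ring_hom_zero[OF hom R.ring_axioms R.ring_axioms]
lemmas funpow_closed [simp] = ring_hom_closed[OF funpow_hom]
  and funpow_mult = ring_hom_mult[OF funpow_hom]
  and funpow_zero [simp] = ring_hom_zero[OF funpow_hom R.ring_axioms R.ring_axioms]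

lemma twist_minus: "a \<in> carrier R \<Longrightarrow> \<sigma> (\<ominus> a) = \<ominus> \<sigma> a"
  using ring_hom_add[OF hom, of "\<ominus> a" a] by (simp add: R.l_neg R.minus_equality)

section \<open>Consequences of the Armendariz condition for idempotents\<close>

lemma coefficients_annihilate:
  assumes "m \<in> fin_supp_funs M" "f \<in> fin_supp_funs R"
    and "\<And>k. (\<Oplus>\<^bsub>M\<^esub>i\<in>{..k}. m i \<cdot>\<^bsub>M\<^esub> (\<sigma> ^^ i) (f (k - i))) = \<zero>\<^bsub>M\<^esub>"
  shows "m i \<cdot>\<^bsub>M\<^esub> (\<sigma> ^^ i) (f j) = \<zero>\<^bsub>M\<^esub>"
  using Armendariz assms
  by (simp add: skew_Armendariz_def skew_poly_module_def skew_poly_ring_def)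

text \<open>The three equations say that the coefficients of 1, x and x^2 in (m + nx)(a + bx)
  vanish; the conclusion is the Armendariz condition at the indices 0 and 1.\<close>

lemma linear_coefficients_annihilate:
  assumes m: "m \<in> carrier M" "n \<in> carrier M" and a: "a \<in> carrier R" "b \<in> carrier R"
    and "m \<cdot>\<^bsub>M\<^esub> a = \<zero>\<^bsub>M\<^esub>" "m \<cdot>\<^bsub>M\<^esub> b \<oplus>\<^bsub>M\<^esub> n \<cdot>\<^bsub>M\<^esub> \<sigma> a = \<zero>\<^bsub>M\<^esub>" "n \<cdot>\<^bsub>M\<^esub> \<sigma> b = \<zero>\<^bsub>M\<^esub>"
  shows "m \<cdot>\<^bsub>M\<^esub> b = \<zero>\<^bsub>M\<^esub>"
proof -
  define p where "p = (\<lambda>i::nat. if i = 0 then m else if i = 1 then n else \<zero>\<^bsub>M\<^esub>)"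
  define f where "f = (\<lambda>i::nat. if i = 0 then a else if i = 1 then b else \<zero>)"
  have "finite {i. p i \<noteq> \<zero>\<^bsub>M\<^esub>}" "finite {i. f i \<noteq> \<zero>}"
    by (rule finite_subset[of _ "{0, 1}"]; auto simp: p_def f_def)+
  then have p: "p \<in> fin_supp_funs M" and f: "f \<in> fin_supp_funs R"
    using m a by (auto simp: fin_supp_funs_def p_def f_def)
  have "(\<Oplus>\<^bsub>M\<^esub>i\<in>{..k}. p i \<cdot>\<^bsub>M\<^esub> (\<sigma> ^^ i) (f (k - i))) = \<zero>\<^bsub>M\<^esub>" for k
  proof -
    consider "k = 0" | "k = 1" | "k \<ge> 2"
      by linarith
    then show ?thesis
    proof cases
      case 1
      then show ?thesis
        using assms by (simp add: p_def f_def)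
    next
      case 2
      have "{..1::nat} = {0, 1}"
        by auto
      then show ?thesis
        using assms 2 by (simp add: p_def f_def M.add.finprod_insert)
    next
      \<comment> \<open>Every summand vanishes because one factor has index at least 2, except for
        \<open>k = 2\<close>, \<open>i = 1\<close>, where the last hypothesis applies.\<close>
      case 3
      then show ?thesis
        using assms by (intro M.add.finprod_one_eqI) (auto simp: p_def f_def)
    qed
  qed
  from coefficients_annihilate[OF p f this, of 0 1] show ?thesis
    by (simp add: p_def f_def)
qed

lemma complement_idempotent:
  assumes "e \<in> carrier R" "e \<otimes> e = e"
  obtains e' where "e' \<in> carrier R" "e' \<otimes> e' = e'" "e \<otimes> e' = \<zero>" "e' \<otimes> e = \<zero>" "e \<oplus> e' = \<one>"
proof
  let ?e = "\<one> \<ominus> e"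
  show c: "?e \<in> carrier R"
    using assms by simp
  show 1: "e \<otimes> ?e = \<zero>" "?e \<otimes> e = \<zero>"
    using assms by (simp_all add: a_minus_def R.r_distr R.l_distr R.r_minus R.l_minus R.r_neg)
  show "?e \<otimes> ?e = ?e"
    using assms 1 by (subst (1) a_minus_def) (simp add: R.l_distr R.l_minus)
  show "e \<oplus> ?e = \<one>"
    using assms R.a_lcomm[of e \<one> "\<ominus> e"] by (simp add: a_minus_def R.r_neg)
qed

text \<open>With \<open>f = 1 - e\<close>, the fact \<open>vanish\<close> gives
  \<open>m f \<sigma>(e) = 0\<close> and, with the roles exchanged,
  \<open>m e \<sigma>(f) = 0\<close>. Hence both sides equal \<open>m e \<sigma>(e)\<close>.\<close>

lemma rsmult_twist_idempotent:
  assumes m: "m \<in> carrier M" and e: "e \<in> carrier R" "e \<otimes> e = e"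
  shows "m \<cdot>\<^bsub>M\<^esub> \<sigma> e = m \<cdot>\<^bsub>M\<^esub> e"
proof -
  \<comment> \<open>Apply the Armendariz condition to \<open>(mf + mf\<sigma>(e)x)(e - f\<sigma>(e)x) = 0\<close>.\<close>
  have vanish: "m \<cdot>\<^bsub>M\<^esub> (f \<otimes> \<sigma> e) = \<zero>\<^bsub>M\<^esub>"
    if e: "e \<in> carrier R" "e \<otimes> e = e" and f: "f \<in> carrier R" "f \<otimes> f = f"
      and ef: "e \<otimes> f = \<zero>" "f \<otimes> e = \<zero>" for e f
  proof -
    have se: "\<sigma> e \<otimes> \<sigma> e = \<sigma> e" "\<sigma> e \<otimes> \<sigma> f = \<zero>"
      using e f ef by (simp_all flip: twist_mult)
    have ff: "f \<otimes> (f \<otimes> \<sigma> e) = f \<otimes> \<sigma> e"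
      using e f by (simp flip: R.m_assoc)
    have "(m \<cdot>\<^bsub>M\<^esub> f) \<cdot>\<^bsub>M\<^esub> (\<ominus> (f \<otimes> \<sigma> e)) = \<zero>\<^bsub>M\<^esub>"
    proof (rule linear_coefficients_annihilate[where a = e and n = "m \<cdot>\<^bsub>M\<^esub> (f \<otimes> \<sigma> e)"])
      show "(m \<cdot>\<^bsub>M\<^esub> f) \<cdot>\<^bsub>M\<^esub> e = \<zero>\<^bsub>M\<^esub>"
        using m e f ef by (simp flip: rsmult_assoc)
      have "(m \<cdot>\<^bsub>M\<^esub> f) \<cdot>\<^bsub>M\<^esub> (\<ominus> (f \<otimes> \<sigma> e)) = \<ominus>\<^bsub>M\<^esub> (m \<cdot>\<^bsub>M\<^esub> (f \<otimes> \<sigma> e))"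
        using m e f ff by (simp add: rsmult_minus_right flip: rsmult_assoc)
      moreover have "(m \<cdot>\<^bsub>M\<^esub> (f \<otimes> \<sigma> e)) \<cdot>\<^bsub>M\<^esub> \<sigma> e = m \<cdot>\<^bsub>M\<^esub> (f \<otimes> \<sigma> e)"
        using m e f se by (simp add: R.m_assoc flip: rsmult_assoc)
      ultimately show "(m \<cdot>\<^bsub>M\<^esub> f) \<cdot>\<^bsub>M\<^esub> (\<ominus> (f \<otimes> \<sigma> e)) \<oplus>\<^bsub>M\<^esub> (m \<cdot>\<^bsub>M\<^esub> (f \<otimes> \<sigma> e)) \<cdot>\<^bsub>M\<^esub> \<sigma> e = \<zero>\<^bsub>M\<^esub>"
        using m e f by (simp add: M.l_neg)
      \<comment> \<open>The coefficient of x^2 contains the factor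
        \<open>\<sigma>(e)\<sigma>(f) = \<sigma>(ef) = 0\<close>.\<close>
      have "(f \<otimes> \<sigma> e) \<otimes> \<sigma> (f \<otimes> \<sigma> e) = f \<otimes> (\<sigma> e \<otimes> \<sigma> f) \<otimes> \<sigma> (\<sigma> e)"
        using e f by (simp add: twist_mult R.m_assoc)
      also have "\<dots> = \<zero>"
        using e f se by simp
      finally have "(f \<otimes> \<sigma> e) \<otimes> \<sigma> (\<ominus> (f \<otimes> \<sigma> e)) = \<zero>"
        using e f by (simp add: twist_minus R.r_minus)
      then show "(m \<cdot>\<^bsub>M\<^esub> (f \<otimes> \<sigma> e)) \<cdot>\<^bsub>M\<^esub> \<sigma> (\<ominus> (f \<otimes> \<sigma> e)) = \<zero>\<^bsub>M\<^esub>"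
        using m e f by (simp flip: rsmult_assoc)
    qed (use m e f in auto)
    then have "\<ominus>\<^bsub>M\<^esub> (m \<cdot>\<^bsub>M\<^esub> (f \<otimes> \<sigma> e)) = \<zero>\<^bsub>M\<^esub>"
      using m e f ff by (simp add: rsmult_minus_right flip: rsmult_assoc)
    then show ?thesis
      using m e f M.r_neg[of "m \<cdot>\<^bsub>M\<^esub> (f \<otimes> \<sigma> e)"] by simp
  qed
  obtain f where f: "f \<in> carrier R" "f \<otimes> f = f" "e \<otimes> f = \<zero>" "f \<otimes> e = \<zero>" "e \<oplus> f = \<one>"
    using complement_idempotent[OF e] by metis
  have sef: "\<sigma> e \<oplus> \<sigma> f = \<one>"
    using e f ring_hom_add[OF hom, of e f] ring_hom_one[OF hom] by simp
  have "m \<cdot>\<^bsub>M\<^esub> \<sigma> e = m \<cdot>\<^bsub>M\<^esub> ((e \<oplus> f) \<otimes> \<sigma> e)"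
    using e f by simp
  also have "\<dots> = m \<cdot>\<^bsub>M\<^esub> (e \<otimes> \<sigma> e)"
    using m e f(1-4) vanish[of e f] by (simp add: R.l_distr rsmult_r_distr)
  also have "\<dots> = m \<cdot>\<^bsub>M\<^esub> (e \<otimes> (\<sigma> e \<oplus> \<sigma> f))"
    using m e f(1-4) vanish[of f e] by (simp add: R.r_distr rsmult_r_distr)
  also have "\<dots> = m \<cdot>\<^bsub>M\<^esub> e"
    using e sef by simp
  finally show ?thesis .
qed

text \<open>Each power of \<open>\<sigma>\<close> sends \<open>e\<close> to an idempotent again, so
  the single twist can be removed repeatedly.\<close>

lemma rsmult_funpow_idempotent:
  assumes m: "m \<in> carrier M" and e: "e \<in> carrier R" "e \<otimes> e = e"
  shows "m \<cdot>\<^bsub>M\<^esub> (\<sigma> ^^ n) e = m \<cdot>\<^bsub>M\<^esub> e"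
proof (induction n)
  case (Suc n)
  have "(\<sigma> ^^ n) e \<otimes> (\<sigma> ^^ n) e = (\<sigma> ^^ n) e"
    using e by (simp flip: funpow_mult)
  then show ?case
    using Suc rsmult_twist_idempotent[OF m, of "(\<sigma> ^^ n) e"] e by simp
qed simp

text \<open>With \<open>f = 1 - e\<close>, the fact \<open>vanish\<close> gives
  \<open>merf = 0\<close> and \<open>mfre = 0\<close>, so both sides equal
  \<open>mere\<close>.\<close>

lemma rsmult_idempotent_commute:
  assumes m: "m \<in> carrier M" and e: "e \<in> carrier R" "e \<otimes> e = e" and r: "r \<in> carrier R"
  shows "m \<cdot>\<^bsub>M\<^esub> (e \<otimes> r) = m \<cdot>\<^bsub>M\<^esub> (r \<otimes> e)"
proof -
  \<comment> \<open>Apply the Armendariz condition to \<open>(me - merfx)(f + erfx) = 0\<close>.\<close>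
  have vanish: "m \<cdot>\<^bsub>M\<^esub> (e \<otimes> r \<otimes> f) = \<zero>\<^bsub>M\<^esub>"
    if e: "e \<in> carrier R" "e \<otimes> e = e" and f: "f \<in> carrier R" "f \<otimes> f = f"
      and ef: "e \<otimes> f = \<zero>" "f \<otimes> e = \<zero>" for e f
  proof -
    let ?t = "e \<otimes> r \<otimes> f"
    let ?n = "m \<cdot>\<^bsub>M\<^esub> (\<ominus> ?t)"
    have t: "?t \<in> carrier R" "e \<otimes> ?t = ?t" "?t \<otimes> f = ?t" "?t \<otimes> e = \<zero>" "?n \<in> carrier M"
      using m e f r ef by (simp_all flip: R.m_assoc) (simp_all add: R.m_assoc)
    \<comment> \<open>A twist on an idempotent is invisible on \<open>M\<close>, so these equations
      reduce to \<open>tf = t\<close> and \<open>te = 0\<close>.\<close>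
    have n: "?n \<cdot>\<^bsub>M\<^esub> \<sigma> f = ?n" "?n \<cdot>\<^bsub>M\<^esub> \<sigma> e = \<zero>\<^bsub>M\<^esub>"
      using m t e f by (simp_all add: rsmult_twist_idempotent R.l_minus flip: rsmult_assoc)
    have "(m \<cdot>\<^bsub>M\<^esub> e) \<cdot>\<^bsub>M\<^esub> ?t = \<zero>\<^bsub>M\<^esub>"
    proof (rule linear_coefficients_annihilate[where a = f and n = ?n])
      show "(m \<cdot>\<^bsub>M\<^esub> e) \<cdot>\<^bsub>M\<^esub> f = \<zero>\<^bsub>M\<^esub>"
        using m e f ef by (simp flip: rsmult_assoc)
      show "(m \<cdot>\<^bsub>M\<^esub> e) \<cdot>\<^bsub>M\<^esub> ?t \<oplus>\<^bsub>M\<^esub> ?n \<cdot>\<^bsub>M\<^esub> \<sigma> f = \<zero>\<^bsub>M\<^esub>"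
        unfolding n using m t e by (simp add: rsmult_minus_right M.r_neg flip: rsmult_assoc)
      have "\<sigma> ?t = \<sigma> e \<otimes> \<sigma> (r \<otimes> f)"
        using e f r by (simp add: R.m_assoc twist_mult)
      then show "?n \<cdot>\<^bsub>M\<^esub> \<sigma> ?t = \<zero>\<^bsub>M\<^esub>"
        using n(2) t e f r by (simp add: rsmult_assoc)
    qed (use m e f t in auto)
    then show ?thesis
      using m t e by (simp flip: rsmult_assoc)
  qed
  obtain f where f: "f \<in> carrier R" "f \<otimes> f = f" "e \<otimes> f = \<zero>" "f \<otimes> e = \<zero>" "e \<oplus> f = \<one>"
    using complement_idempotent[OF e] by metis
  have "m \<cdot>\<^bsub>M\<^esub> (e \<otimes> r) = m \<cdot>\<^bsub>M\<^esub> (e \<otimes> r \<otimes> (e \<oplus> f))"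
    using e f r by simp
  also have "\<dots> = m \<cdot>\<^bsub>M\<^esub> (e \<otimes> r \<otimes> e)"
    using m e f(1-4) r vanish[of e f] by (simp add: R.r_distr rsmult_r_distr)
  also have "\<dots> = m \<cdot>\<^bsub>M\<^esub> ((e \<oplus> f) \<otimes> r \<otimes> e)"
    using m e f(1-4) r vanish[of f e] by (simp add: R.l_distr rsmult_r_distr)
  also have "\<dots> = m \<cdot>\<^bsub>M\<^esub> (r \<otimes> e)"
    using e f r by simp
  finally show ?thesis .
qed

section \<open>Annihilators and powers of the twist\<close>

lemma C2_funpow:
  assumes "condition_C2 R \<sigma> M" "m \<in> carrier M" "a \<in> carrier R" "m \<cdot>\<^bsub>M\<^esub> (\<sigma> ^^ n) a = \<zero>\<^bsub>M\<^esub>"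
  shows "m \<cdot>\<^bsub>M\<^esub> a = \<zero>\<^bsub>M\<^esub>"
  using assms(4)
proof (induction n)
  case (Suc n)
  have "m \<cdot>\<^bsub>M\<^esub> \<sigma> ((\<sigma> ^^ n) a) = \<zero>\<^bsub>M\<^esub>"
    using Suc.prems by simp
  then have "m \<cdot>\<^bsub>M\<^esub> (\<sigma> ^^ n) a = \<zero>\<^bsub>M\<^esub>"
    using assms(1-3) funpow_closed[of a n] unfolding condition_C2_def by blast
  then show ?case
    by (rule Suc.IH)
qed simp

text \<open>Outside the finite support only the value zero occurs, so the range of \<open>m\<close>
  is finite and the result on finite sets applies. The index type is left open to cover exponents in
  \<open>nat\<close> and in \<open>int\<close>.\<close>

lemma fin_supp_support_annihilator:
  fixes m :: "'i \<Rightarrow> 'b"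
  assumes pp: "pp_module R M" and m: "m \<in> fin_supp_funs M"
  obtains e where "e \<in> carrier R" "e \<otimes> e = e"
    "\<And>a. a \<in> carrier R \<Longrightarrow> (\<forall>i. m i \<cdot>\<^bsub>M\<^esub> a = \<zero>\<^bsub>M\<^esub>) \<longleftrightarrow> e \<otimes> a = a"
proof -
  have "range m \<subseteq> insert \<zero>\<^bsub>M\<^esub> (m ` {i. m i \<noteq> \<zero>\<^bsub>M\<^esub>})"
    by auto
  then have fin: "finite (range m)"
    by (rule finite_subset) (use m in \<open>simp add: fin_supp_funs_def\<close>)
  have sub: "range m \<subseteq> carrier M"
    using m by (auto simp: fin_supp_funs_def)
  have "\<exists>e\<in>carrier R. e \<otimes> e = e \<and>
      (\<forall>a\<in>carrier R. (\<forall>n\<in>range m. n \<cdot>\<^bsub>M\<^esub> a = \<zero>\<^bsub>M\<^esub>) \<longleftrightarrow> e \<otimes> a = a)"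
    by (rule pp_module_finite_annihilator[OF pp _ fin sub]) (rule rsmult_idempotent_commute)
  then obtain e where "e \<in> carrier R" "e \<otimes> e = e"
    and "\<forall>a\<in>carrier R. (\<forall>n\<in>range m. n \<cdot>\<^bsub>M\<^esub> a = \<zero>\<^bsub>M\<^esub>) \<longleftrightarrow> e \<otimes> a = a"
    by (elim bexE conjE)
  then show thesis
    by (intro that) simp_all
qed

text \<open>Writing \<open>a = ea\<close> with \<open>me = 0\<close>, the twisted element starts
  with the twisted \<open>e\<close>, which acts on \<open>m\<close> as \<open>e\<close> does. This
  is the converse direction to \<open>C2\<close>.\<close>

lemma pp_module_twist_annihilates:
  assumes pp: "pp_module R M" and m: "m \<in> carrier M" and a: "a \<in> carrier R"
    and ma: "m \<cdot>\<^bsub>M\<^esub> a = \<zero>\<^bsub>M\<^esub>"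
  shows "m \<cdot>\<^bsub>M\<^esub> (\<sigma> ^^ n) a = \<zero>\<^bsub>M\<^esub>"
proof -
  obtain e where e: "e \<in> carrier R" "e \<otimes> e = e"
    and ann: "\<forall>a\<in>carrier R. m \<cdot>\<^bsub>M\<^esub> a = \<zero>\<^bsub>M\<^esub> \<longleftrightarrow> e \<otimes> a = a"
    using pp m unfolding pp_module_iff by blast
  then have ea: "e \<otimes> a = a" and me: "m \<cdot>\<^bsub>M\<^esub> e = \<zero>\<^bsub>M\<^esub>"
    using a ma by simp_all
  have "m \<cdot>\<^bsub>M\<^esub> (\<sigma> ^^ n) a = m \<cdot>\<^bsub>M\<^esub> ((\<sigma> ^^ n) e \<otimes> (\<sigma> ^^ n) a)"
    using e a ea funpow_mult[of e a n] by simp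
  also have "\<dots> = (m \<cdot>\<^bsub>M\<^esub> (\<sigma> ^^ n) e) \<cdot>\<^bsub>M\<^esub> (\<sigma> ^^ n) a"
    using m e a by (simp add: rsmult_assoc)
  also have "\<dots> = \<zero>\<^bsub>M\<^esub>"
    using m a me rsmult_funpow_idempotent[OF m e] by simp
  finally show ?thesis .
qed

end

section \<open>Polynomials and Laurent polynomials\<close>

text \<open>The open exponent type makes this the constant polynomial and the constant Laurent
  polynomial at once, over the ring as well as over the module.\<close>

definition const_coeff :: "('b, 'm) ring_scheme \<Rightarrow> 'b \<Rightarrow> 'i::zero \<Rightarrow> 'b" where
  "const_coeff A a = (\<lambda>i. if i = 0 then a else \<zero>\<^bsub>A\<^esub>)"

lemma const_coeff_0 [simp]: "const_coeff A a 0 = a"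
  by (simp add: const_coeff_def)

lemma const_coeff_fin_supp:
  assumes "a \<in> carrier A" "\<zero>\<^bsub>A\<^esub> \<in> carrier A"
  shows "const_coeff A a \<in> fin_supp_funs A"
  using assms by (auto simp: fin_supp_funs_def const_coeff_def intro: finite_subset[of _ "{0}"])

text \<open>Shifting exponents by \<open>s\<close> turns a Laurent polynomial into a polynomial; the
  bound on \<open>j\<close> keeps a prescribed coefficient in view even if it is zero.\<close>

lemma finite_support_bounded_below:
  fixes f :: "int \<Rightarrow> 'c"
  assumes "finite {i. f i \<noteq> z}"
  shows "\<exists>s::nat. (\<forall>l < - int s. f l = z) \<and> - int s \<le> j"
proof -
  \<comment> \<open>Inserting \<open>j\<close> makes the set nonempty, so that its minimum is
    meaningful, and forces the bound below \<open>j\<close>.\<close>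
  let ?A = "insert j {i. f i \<noteq> z}"
  have lower: "Min ?A \<le> l" if "l \<in> ?A" for l
    using assms that by (intro Min_le) auto
  have "f l = z" if "l < - int (nat (- Min ?A))" for l
  proof (rule ccontr)
    assume "f l \<noteq> z"
    then have "Min ?A \<le> l"
      by (intro lower) simp
    then show False
      using that by linarith
  qed
  moreover have "- int (nat (- Min ?A)) \<le> j"
    using lower[OF insertI1] by linarith
  ultimately show ?thesis
    by blast
qed

section \<open>The equivalence for skew polynomials\<close>

context skew_Armendariz_module
begin

lemma const_coeff_mult_skew_poly:
  assumes "a \<in> carrier R" "f \<in> fin_supp_funs R"
  shows "const_coeff R a \<otimes>\<^bsub>skew_poly_ring R \<sigma>\<^esub> f = (\<lambda>k. a \<otimes> f k)"
proof
  fix k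
  have "(\<Oplus>i\<in>{..k}. const_coeff R a i \<otimes> (\<sigma> ^^ i) (f (k - i))) = (\<Oplus>i\<in>{0::nat}. a \<otimes> f k)"
    using assms
    by (intro R.add.finprod_mono_neutral_cong_right) (auto simp: const_coeff_def fin_supp_funs_def)
  then show "(const_coeff R a \<otimes>\<^bsub>skew_poly_ring R \<sigma>\<^esub> f) k = a \<otimes> f k"
    using assms by (simp add: skew_poly_ring_def fin_supp_funs_def)
qed

lemma const_coeff_rsmult_skew_poly:
  assumes "m \<in> carrier M" "f \<in> fin_supp_funs R"
  shows "const_coeff M m \<cdot>\<^bsub>skew_poly_module R \<sigma> M\<^esub> f = (\<lambda>k. m \<cdot>\<^bsub>M\<^esub> f k)"
proof
  fix k
  have "(\<Oplus>\<^bsub>M\<^esub>i\<in>{..k}. const_coeff M m i \<cdot>\<^bsub>M\<^esub> (\<sigma> ^^ i) (f (k - i))) = (\<Oplus>\<^bsub>M\<^esub>i\<in>{0::nat}. m \<cdot>\<^bsub>M\<^esub> f k)"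
    using assms
    by (intro M.add.finprod_mono_neutral_cong_right) (auto simp: const_coeff_def fin_supp_funs_def)
  then show "(const_coeff M m \<cdot>\<^bsub>skew_poly_module R \<sigma> M\<^esub> f) k = m \<cdot>\<^bsub>M\<^esub> f k"
    using assms by (simp add: skew_poly_module_def fin_supp_funs_def)
qed

lemma pp_skew_poly_module:
  assumes pp: "pp_module R M" and C2: "condition_C2 R \<sigma> M"
  shows "pp_module (skew_poly_ring R \<sigma>) (skew_poly_module R \<sigma> M)"
  unfolding pp_module_def
proof
  fix m assume "m \<in> carrier (skew_poly_module R \<sigma> M)"
  then have m: "m \<in> fin_supp_funs M"
    by (simp add: skew_poly_module_def)
  then have [simp]: "m i \<in> carrier M" for i
    by (simp add: fin_supp_funs_def)
  obtain e where e: "e \<in> carrier R" "e \<otimes> e = e"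
    and ann: "\<And>a. a \<in> carrier R \<Longrightarrow> (\<forall>i. m i \<cdot>\<^bsub>M\<^esub> a = \<zero>\<^bsub>M\<^esub>) \<longleftrightarrow> e \<otimes> a = a"
    using fin_supp_support_annihilator[OF pp m] by metis
  define E where "E = (const_coeff R e :: nat \<Rightarrow> 'a)"
  have E: "E \<in> fin_supp_funs R"
    using e by (simp add: E_def const_coeff_fin_supp)
  have mult: "E \<otimes>\<^bsub>skew_poly_ring R \<sigma>\<^esub> f = (\<lambda>k. e \<otimes> f k)" if "f \<in> fin_supp_funs R" for f
    using const_coeff_mult_skew_poly[OF e(1) that] by (simp add: E_def)
  have idem: "E \<otimes>\<^bsub>skew_poly_ring R \<sigma>\<^esub> E = E"
    unfolding mult[OF E] using e by (auto simp: E_def const_coeff_def)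
  \<comment> \<open>First inclusion: the Armendariz condition separates the coefficients,
    \<open>C2\<close> strips the twists, and so every \<open>f j\<close> lies in
    \<open>eR\<close>.\<close>
  have fixed: "f = E \<otimes>\<^bsub>skew_poly_ring R \<sigma>\<^esub> f"
    if f: "f \<in> fin_supp_funs R" and mf: "m \<cdot>\<^bsub>skew_poly_module R \<sigma> M\<^esub> f = (\<lambda>i. \<zero>\<^bsub>M\<^esub>)" for f
  proof -
    have fc: "f j \<in> carrier R" for j
      using f by (simp add: fin_supp_funs_def)
    have "m i \<cdot>\<^bsub>M\<^esub> (\<sigma> ^^ i) (f j) = \<zero>\<^bsub>M\<^esub>" for i j
      using mf by (intro coefficients_annihilate[OF m f]) (simp add: skew_poly_module_def fun_eq_iff)
    then have "m i \<cdot>\<^bsub>M\<^esub> f j = \<zero>\<^bsub>M\<^esub>" for i j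
      by (rule C2_funpow[OF C2 _ fc, rotated]) simp
    then have "e \<otimes> f j = f j" for j
      using ann fc by blast
    then show ?thesis
      using mult[OF f] by simp
  qed
  \<comment> \<open>Second inclusion: each summand vanishes separately, because every twist of
    \<open>e\<close> is killed by every \<open>m i\<close>.\<close>
  have killed: "m \<cdot>\<^bsub>skew_poly_module R \<sigma> M\<^esub> (E \<otimes>\<^bsub>skew_poly_ring R \<sigma>\<^esub> g) = (\<lambda>i. \<zero>\<^bsub>M\<^esub>)"
    and closed: "E \<otimes>\<^bsub>skew_poly_ring R \<sigma>\<^esub> g \<in> fin_supp_funs R"
    if g: "g \<in> fin_supp_funs R" for g
  proof -
    have gc: "g j \<in> carrier R" for j
      using g by (simp add: fin_supp_funs_def)
    have me: "m i \<cdot>\<^bsub>M\<^esub> (\<sigma> ^^ n) e = \<zero>\<^bsub>M\<^esub>" for i n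
      using ann[of e] e rsmult_funpow_idempotent[of "m i" e n] by simp
    have "m i \<cdot>\<^bsub>M\<^esub> (\<sigma> ^^ i) (e \<otimes> g j) = \<zero>\<^bsub>M\<^esub>" for i j
      using me e gc by (simp add: funpow_mult rsmult_assoc)
    then show "m \<cdot>\<^bsub>skew_poly_module R \<sigma> M\<^esub> (E \<otimes>\<^bsub>skew_poly_ring R \<sigma>\<^esub> g) = (\<lambda>i. \<zero>\<^bsub>M\<^esub>)"
      unfolding mult[OF g] by (simp add: skew_poly_module_def M.finsum_zero)
    have "finite {i. e \<otimes> g i \<noteq> \<zero>}"
      by (rule finite_subset[of _ "{i. g i \<noteq> \<zero>}"]) (use g e in \<open>auto simp: fin_supp_funs_def\<close>)
    then show "E \<otimes>\<^bsub>skew_poly_ring R \<sigma>\<^esub> g \<in> fin_supp_funs R"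
      unfolding mult[OF g] using g e by (simp add: fin_supp_funs_def)
  qed
  have carr: "carrier (skew_poly_ring R \<sigma>) = fin_supp_funs R"
    "\<zero>\<^bsub>skew_poly_module R \<sigma> M\<^esub> = (\<lambda>i. \<zero>\<^bsub>M\<^esub>)"
    by (simp_all add: skew_poly_ring_def skew_poly_module_def)
  have "right_annihilator (skew_poly_ring R \<sigma>) (skew_poly_module R \<sigma> M) m =
      {E \<otimes>\<^bsub>skew_poly_ring R \<sigma>\<^esub> a | a. a \<in> fin_supp_funs R}"
    unfolding right_annihilator_def carr
  proof (intro equalityI subsetI; elim CollectE exE conjE)
    fix f assume "f \<in> fin_supp_funs R" "m \<cdot>\<^bsub>skew_poly_module R \<sigma> M\<^esub> f = (\<lambda>i. \<zero>\<^bsub>M\<^esub>)"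
    then show "f \<in> {E \<otimes>\<^bsub>skew_poly_ring R \<sigma>\<^esub> a | a. a \<in> fin_supp_funs R}"
      using fixed by blast
  next
    fix f g assume "f = E \<otimes>\<^bsub>skew_poly_ring R \<sigma>\<^esub> g" "g \<in> fin_supp_funs R"
    then show "f \<in> {f \<in> fin_supp_funs R. m \<cdot>\<^bsub>skew_poly_module R \<sigma> M\<^esub> f = (\<lambda>i. \<zero>\<^bsub>M\<^esub>)}"
      using killed closed by simp
  qed
  then show "\<exists>e\<in>carrier (skew_poly_ring R \<sigma>). e \<otimes>\<^bsub>skew_poly_ring R \<sigma>\<^esub> e = e \<and>
      right_annihilator (skew_poly_ring R \<sigma>) (skew_poly_module R \<sigma> M) m =
        {e \<otimes>\<^bsub>skew_poly_ring R \<sigma>\<^esub> a | a. a \<in> carrier (skew_poly_ring R \<sigma>)}"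
    unfolding carr using E idem by blast
qed

text \<open>Over natural exponents 0 splits only as 0 + 0, so taking constant coefficients is
  multiplicative and carries idempotency and factorizations through \<open>E\<close> down to
  \<open>R\<close>.\<close>

lemma pp_module_of_skew_poly:
  assumes pp: "pp_module (skew_poly_ring R \<sigma>) (skew_poly_module R \<sigma> M)"
  shows "pp_module R M"
  unfolding pp_module_iff
proof
  fix m assume m: "m \<in> carrier M"
  have carr: "carrier (skew_poly_ring R \<sigma>) = fin_supp_funs R"
    "carrier (skew_poly_module R \<sigma> M) = fin_supp_funs M"
    "\<zero>\<^bsub>skew_poly_module R \<sigma> M\<^esub> = (\<lambda>i. \<zero>\<^bsub>M\<^esub>)"
    by (simp_all add: skew_poly_ring_def skew_poly_module_def)
  have cm: "(const_coeff M m :: nat \<Rightarrow> 'b) \<in> fin_supp_funs M"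
    using m by (simp add: const_coeff_fin_supp)
  obtain E where E: "E \<in> fin_supp_funs R" "E \<otimes>\<^bsub>skew_poly_ring R \<sigma>\<^esub> E = E"
    and ann: "right_annihilator (skew_poly_ring R \<sigma>) (skew_poly_module R \<sigma> M) (const_coeff M m) =
        {E \<otimes>\<^bsub>skew_poly_ring R \<sigma>\<^esub> a | a. a \<in> fin_supp_funs R}"
    using pp cm unfolding pp_module_def carr by blast
  have E0: "E 0 \<in> carrier R"
    using E by (simp add: fin_supp_funs_def)
  have mult0: "(E \<otimes>\<^bsub>skew_poly_ring R \<sigma>\<^esub> g) 0 = E 0 \<otimes> g 0" if "g \<in> fin_supp_funs R" for g
    using that E by (simp add: skew_poly_ring_def fin_supp_funs_def)
  have idem: "E 0 \<otimes> E 0 = E 0"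
    using mult0[OF E(1)] E(2) by simp
  \<comment> \<open>\<open>E\<close> lies in the right ideal it generates because
    \<open>E = E E\<close>.\<close>
  have "E \<in> right_annihilator (skew_poly_ring R \<sigma>) (skew_poly_module R \<sigma> M) (const_coeff M m)"
    unfolding ann using E by force
  then have "const_coeff M m \<cdot>\<^bsub>skew_poly_module R \<sigma> M\<^esub> E = (\<lambda>i. \<zero>\<^bsub>M\<^esub>)"
    by (simp add: right_annihilator_def carr)
  then have mE: "m \<cdot>\<^bsub>M\<^esub> E 0 = \<zero>\<^bsub>M\<^esub>"
    unfolding const_coeff_rsmult_skew_poly[OF m E(1)] by (simp add: fun_eq_iff)
  have "m \<cdot>\<^bsub>M\<^esub> a = \<zero>\<^bsub>M\<^esub> \<longleftrightarrow> E 0 \<otimes> a = a" if a: "a \<in> carrier R" for a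
  proof
    assume ma: "m \<cdot>\<^bsub>M\<^esub> a = \<zero>\<^bsub>M\<^esub>"
    have ca: "(const_coeff R a :: nat \<Rightarrow> 'a) \<in> fin_supp_funs R"
      using a by (simp add: const_coeff_fin_supp)
    have "const_coeff R a \<in> right_annihilator (skew_poly_ring R \<sigma>) (skew_poly_module R \<sigma> M) (const_coeff M m)"
      using m ma ca const_coeff_rsmult_skew_poly[OF m ca]
      by (auto simp: right_annihilator_def carr const_coeff_def)
    then obtain g where g: "g \<in> fin_supp_funs R" "const_coeff R a = E \<otimes>\<^bsub>skew_poly_ring R \<sigma>\<^esub> g"
      unfolding ann by blast
    then have "a = E 0 \<otimes> g 0"
      using mult0[OF g(1)] by (metis const_coeff_0)
    moreover have "g 0 \<in> carrier R"
      using g by (simp add: fin_supp_funs_def)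
    ultimately show "E 0 \<otimes> a = a"
      using idem E0 by (simp flip: R.m_assoc)
  next
    assume "E 0 \<otimes> a = a"
    then show "m \<cdot>\<^bsub>M\<^esub> a = \<zero>\<^bsub>M\<^esub>"
      using m E0 a mE by (metis rsmult_assoc rsmult_zero_left)
  qed
  then show "\<exists>e\<in>carrier R. e \<otimes> e = e \<and> (\<forall>a\<in>carrier R. m \<cdot>\<^bsub>M\<^esub> a = \<zero>\<^bsub>M\<^esub> \<longleftrightarrow> e \<otimes> a = a)"
    using E0 idem by blast
qed

end

section \<open>The equivalence for skew Laurent polynomials\<close>

locale skew_Armendariz_module_aut =
  skew_Armendariz_module R M \<sigma> + ring_automorphism R \<sigma>
  for R :: "('a, 'r) ring_scheme" (structure)
  and M :: "('a, 'b, 'm) right_module_scheme" (structure)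
  and \<sigma> :: "'a \<Rightarrow> 'a"
begin

text \<open>For negative \<open>i\<close> the twisted element is an idempotent that a positive power
  of \<open>\<sigma>\<close> brings back to \<open>e\<close>; the nonnegative case applied to it
  reads backwards.\<close>

lemma rsmult_aut_power_idempotent:
  assumes m: "m \<in> carrier M" and e: "e \<in> carrier R" "e \<otimes> e = e"
  shows "m \<cdot>\<^bsub>M\<^esub> aut_power R \<sigma> i e = m \<cdot>\<^bsub>M\<^esub> e"
proof (cases "0 \<le> i")
  case True
  then show ?thesis
    using rsmult_funpow_idempotent[OF assms] by (simp add: aut_power_def)
next
  case False
  let ?d = "aut_power R \<sigma> i e"
  have d: "?d \<in> carrier R" "?d \<otimes> ?d = ?d"
    using e by (simp_all flip: aut_power_mult)
  have "(\<sigma> ^^ nat (- i)) ?d = e"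
    using e False aut_power_add[OF e(1), of "- i" i] by (simp flip: aut_power_of_nat)
  then show ?thesis
    using rsmult_funpow_idempotent[OF m d, of "nat (- i)"] by simp
qed

text \<open>Nonnegative powers are stripped by \<open>C2\<close>. A negative power is undone by
  applying a positive one, which preserves annihilation over a p.p.-module.\<close>

lemma pp_module_aut_power_annihilates:
  assumes pp: "pp_module R M" and C2: "condition_C2 R \<sigma> M"
    and m: "m \<in> carrier M" and a: "a \<in> carrier R" and ma: "m \<cdot>\<^bsub>M\<^esub> aut_power R \<sigma> i a = \<zero>\<^bsub>M\<^esub>"
  shows "m \<cdot>\<^bsub>M\<^esub> a = \<zero>\<^bsub>M\<^esub>"
proof (cases "0 \<le> i")
  case True
  then show ?thesis
    using C2_funpow[OF C2 m a] ma by (simp add: aut_power_def)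
next
  case False
  have "(\<sigma> ^^ nat (- i)) (aut_power R \<sigma> i a) = a"
    using a False aut_power_add[OF a, of "- i" i] by (simp flip: aut_power_of_nat)
  then show ?thesis
    using pp_module_twist_annihilates[OF pp m _ ma, of "nat (- i)"] a by simp
qed

lemma laurent_coefficients_annihilate:
  assumes m: "m \<in> fin_supp_funs M" and f: "f \<in> fin_supp_funs R"
    and mf: "m \<cdot>\<^bsub>skew_laurent_module R \<sigma> M\<^esub> f = (\<lambda>i. \<zero>\<^bsub>M\<^esub>)"
  shows "m i \<cdot>\<^bsub>M\<^esub> aut_power R \<sigma> i (f j) = \<zero>\<^bsub>M\<^esub>"
proof -
  \<comment> \<open>For large \<open>s, t\<close> both \<open>p = m x^s\<close> and \<open>q = x^(-s) f x^(s+t)\<close> are polynomials, and \<open>p q = m f x^(s+t)\<close>.\<close>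
  let ?s = "aut_power R \<sigma>"
  have mc [simp]: "m i \<in> carrier M" and fc [simp]: "f i \<in> carrier R" for i
    using m f by (simp_all add: fin_supp_funs_def)
  have fin: "finite {i. m i \<noteq> \<zero>\<^bsub>M\<^esub>}" "finite {i. f i \<noteq> \<zero>}"
    using m f by (simp_all add: fin_supp_funs_def)
  obtain s :: nat where s: "\<And>l. l < - int s \<Longrightarrow> m l = \<zero>\<^bsub>M\<^esub>" and si: "- int s \<le> i"
    using finite_support_bounded_below[OF fin(1), of i] by blast
  obtain t :: nat where t: "\<And>l. l < - int t \<Longrightarrow> f l = \<zero>" and tj: "- int t \<le> j"
    using finite_support_bounded_below[OF fin(2), of j] by blast
  define p where "p = (\<lambda>n. m (int n - int s))"
  \<comment> \<open>Moving x^(-s) past a coefficient twists it by the power \<open>- s\<close>; the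
    total shift of exponents in x^(-s) f x^(s+t) is \<open>t\<close>.\<close>
  define q where "q = (\<lambda>n. ?s (- int s) (f (int n - int t)))"
  have "finite {n. p n \<noteq> \<zero>\<^bsub>M\<^esub>}"
    using finite_vimageI[OF fin(1), of "\<lambda>n. int n - int s"]
    by (simp add: p_def vimage_def inj_on_def)
  then have p: "p \<in> fin_supp_funs M"
    by (simp add: fin_supp_funs_def p_def)
  have "finite {n. f (int n - int t) \<noteq> \<zero>}"
    using finite_vimageI[OF fin(2), of "\<lambda>n. int n - int t"]
    by (simp add: vimage_def inj_on_def)
  then have "finite {n. q n \<noteq> \<zero>}"
    by (rule rev_finite_subset) (auto simp: q_def)
  then have q: "q \<in> fin_supp_funs R"
    by (simp add: fin_supp_funs_def q_def)
  \<comment> \<open>The built-in power \<open>- s\<close> corrects the twist at position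
    \<open>n\<close> to the one belonging to the original exponent \<open>n - s\<close> of
    \<open>m\<close>.\<close>
  have pq: "(\<sigma> ^^ n) (q l) = ?s (int n - int s) (f (int l - int t))" for n l
    using aut_power_add[of "f (int l - int t)" "int n" "- int s"]
    by (simp add: q_def flip: aut_power_of_nat)
  have "(\<Oplus>\<^bsub>M\<^esub>n\<in>{..k}. p n \<cdot>\<^bsub>M\<^esub> (\<sigma> ^^ n) (q (k - n))) = \<zero>\<^bsub>M\<^esub>" for k
  proof -
    let ?K = "int k - int s - int t"
    have "(\<Oplus>\<^bsub>M\<^esub>n\<in>{..k}. p n \<cdot>\<^bsub>M\<^esub> (\<sigma> ^^ n) (q (k - n))) =
        (\<Oplus>\<^bsub>M\<^esub>n\<in>{..k}. m (int n - int s) \<cdot>\<^bsub>M\<^esub> ?s (int n - int s) (f (?K - (int n - int s))))"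
      by (intro M.finsum_cong') (auto simp: pq p_def of_nat_diff algebra_simps)
    also have "\<dots> = (\<Oplus>\<^bsub>M\<^esub>l\<in>(\<lambda>n. int n - int s) ` {..k}. m l \<cdot>\<^bsub>M\<^esub> ?s l (f (?K - l)))"
      by (subst M.finsum_reindex) (auto simp: inj_on_def)
    also have "\<dots> = (\<Oplus>\<^bsub>M\<^esub>l\<in>{l. m l \<noteq> \<zero>\<^bsub>M\<^esub>}. m l \<cdot>\<^bsub>M\<^esub> ?s l (f (?K - l)))"
    proof (rule M.add.finprod_mono_neutral_cong)
      show "m l \<cdot>\<^bsub>M\<^esub> ?s l (f (?K - l)) = \<zero>\<^bsub>M\<^esub>"
        if "l \<in> {l. m l \<noteq> \<zero>\<^bsub>M\<^esub>} - (\<lambda>n. int n - int s) ` {..k}" for l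
      proof -
        \<comment> \<open>A support index \<open>l\<close> outside the image satisfies
          \<open>l + s > k\<close>, so the matching exponent of \<open>f\<close> falls below
          \<open>- t\<close>.\<close>
        have "- int s \<le> l"
          using that s[of l] by force
        then have "l = int (nat (l + int s)) - int s"
          by simp
        then have "\<not> nat (l + int s) \<le> k"
          using that by blast
        then have "?K - l < - int t"
          by linarith
        then show ?thesis
          using t by simp
      qed
    qed (use fin in auto)
    also have "\<dots> = (m \<cdot>\<^bsub>skew_laurent_module R \<sigma> M\<^esub> f) ?K"
      by (simp add: skew_laurent_module_def)
    finally show ?thesis
      using mf by simp
  qed
  \<comment> \<open>The shifted positions of \<open>m i\<close> and \<open>f j\<close>; both are
    nonnegative by the choice of \<open>s\<close> and \<open>t\<close>.\<close>
  from coefficients_annihilate[OF p q this, of "nat (i + int s)" "nat (j + int t)"]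
  show ?thesis
    using si tj by (simp add: pq) (simp add: p_def)
qed

lemma const_coeff_mult_skew_laurent:
  assumes "a \<in> carrier R" "f \<in> fin_supp_funs R"
  shows "const_coeff R a \<otimes>\<^bsub>skew_laurent_ring R \<sigma>\<^esub> f = (\<lambda>k. a \<otimes> f k)"
proof
  fix k
  \<comment> \<open>The range is widened to \<open>{0}\<close> because the support is empty when
    \<open>a\<close> is zero.\<close>
  have "(const_coeff R a \<otimes>\<^bsub>skew_laurent_ring R \<sigma>\<^esub> f) k =
      (\<Oplus>i\<in>{0}. const_coeff R a i \<otimes> aut_power R \<sigma> i (f (k - i)))"
    using assms by (intro mult_skew_laurent_widen const_coeff_fin_supp) (auto simp: const_coeff_def)
  then show "(const_coeff R a \<otimes>\<^bsub>skew_laurent_ring R \<sigma>\<^esub> f) k = a \<otimes> f k"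
    using assms by (simp add: fin_supp_funs_def)
qed

lemma const_coeff_rsmult_skew_laurent:
  assumes "m \<in> carrier M" "f \<in> fin_supp_funs R"
  shows "const_coeff M m \<cdot>\<^bsub>skew_laurent_module R \<sigma> M\<^esub> f = (\<lambda>k. m \<cdot>\<^bsub>M\<^esub> f k)"
proof
  fix k
  have "(\<Oplus>\<^bsub>M\<^esub>i\<in>{i. const_coeff M m i \<noteq> \<zero>\<^bsub>M\<^esub>}. const_coeff M m i \<cdot>\<^bsub>M\<^esub> aut_power R \<sigma> i (f (k - i))) =
      (\<Oplus>\<^bsub>M\<^esub>i\<in>{0::int}. m \<cdot>\<^bsub>M\<^esub> f k)"
    using assms
    by (intro M.add.finprod_mono_neutral_cong_left) (auto simp: const_coeff_def fin_supp_funs_def)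
  then show "(const_coeff M m \<cdot>\<^bsub>skew_laurent_module R \<sigma> M\<^esub> f) k = m \<cdot>\<^bsub>M\<^esub> f k"
    using assms by (simp add: skew_laurent_module_def fin_supp_funs_def)
qed

text \<open>The constant idempotent works as for polynomials; twists of either sign are removed by
  \<open>pp_module_aut_power_annihilates\<close> in one inclusion and by
  \<open>rsmult_aut_power_idempotent\<close> in the other.\<close>

lemma pp_skew_laurent_module:
  assumes pp: "pp_module R M" and C2: "condition_C2 R \<sigma> M"
  shows "pp_module (skew_laurent_ring R \<sigma>) (skew_laurent_module R \<sigma> M)"
  unfolding pp_module_def
proof
  fix m assume "m \<in> carrier (skew_laurent_module R \<sigma> M)"
  then have m: "m \<in> fin_supp_funs M"
    by (simp add: skew_laurent_module_def)
  then have [simp]: "m i \<in> carrier M" for i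
    by (simp add: fin_supp_funs_def)
  obtain e where e: "e \<in> carrier R" "e \<otimes> e = e"
    and ann: "\<And>a. a \<in> carrier R \<Longrightarrow> (\<forall>i. m i \<cdot>\<^bsub>M\<^esub> a = \<zero>\<^bsub>M\<^esub>) \<longleftrightarrow> e \<otimes> a = a"
    using fin_supp_support_annihilator[OF pp m] by metis
  define E where "E = (const_coeff R e :: int \<Rightarrow> 'a)"
  have E: "E \<in> fin_supp_funs R"
    using e by (simp add: E_def const_coeff_fin_supp)
  have mult: "E \<otimes>\<^bsub>skew_laurent_ring R \<sigma>\<^esub> f = (\<lambda>k. e \<otimes> f k)" if "f \<in> fin_supp_funs R" for f
    using const_coeff_mult_skew_laurent[OF e(1) that] by (simp add: E_def)
  have idem: "E \<otimes>\<^bsub>skew_laurent_ring R \<sigma>\<^esub> E = E"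
    unfolding mult[OF E] using e by (auto simp: E_def const_coeff_def)
  have fixed: "f = E \<otimes>\<^bsub>skew_laurent_ring R \<sigma>\<^esub> f"
    if f: "f \<in> fin_supp_funs R" and mf: "m \<cdot>\<^bsub>skew_laurent_module R \<sigma> M\<^esub> f = (\<lambda>i. \<zero>\<^bsub>M\<^esub>)" for f
  proof -
    have fc: "f j \<in> carrier R" for j
      using f by (simp add: fin_supp_funs_def)
    have "m i \<cdot>\<^bsub>M\<^esub> f j = \<zero>\<^bsub>M\<^esub>" for i j
      using pp_module_aut_power_annihilates[OF pp C2 _ fc laurent_coefficients_annihilate[OF m f mf]]
      by simp
    then have "e \<otimes> f j = f j" for j
      using ann fc by blast
    then show ?thesis
      using mult[OF f] by simp
  qed
  have killed: "m \<cdot>\<^bsub>skew_laurent_module R \<sigma> M\<^esub> (E \<otimes>\<^bsub>skew_laurent_ring R \<sigma>\<^esub> g) = (\<lambda>i. \<zero>\<^bsub>M\<^esub>)"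
    if g: "g \<in> fin_supp_funs R" for g
  proof -
    have gc: "g j \<in> carrier R" for j
      using g by (simp add: fin_supp_funs_def)
    have me: "m i \<cdot>\<^bsub>M\<^esub> aut_power R \<sigma> n e = \<zero>\<^bsub>M\<^esub>" for i n
      using ann[of e] e rsmult_aut_power_idempotent[of "m i" e n] by simp
    have "m i \<cdot>\<^bsub>M\<^esub> aut_power R \<sigma> i (e \<otimes> g j) = \<zero>\<^bsub>M\<^esub>" for i j
      using me e gc by (simp add: aut_power_mult rsmult_assoc)
    then show ?thesis
      unfolding mult[OF g] by (simp add: skew_laurent_module_def M.finsum_zero)
  qed
  have carr: "carrier (skew_laurent_ring R \<sigma>) = fin_supp_funs R"
    "\<zero>\<^bsub>skew_laurent_module R \<sigma> M\<^esub> = (\<lambda>i. \<zero>\<^bsub>M\<^esub>)"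
    by (simp_all add: skew_laurent_ring_def skew_laurent_module_def)
  have "right_annihilator (skew_laurent_ring R \<sigma>) (skew_laurent_module R \<sigma> M) m =
      {E \<otimes>\<^bsub>skew_laurent_ring R \<sigma>\<^esub> a | a. a \<in> fin_supp_funs R}"
    unfolding right_annihilator_def carr
  proof (intro equalityI subsetI; elim CollectE exE conjE)
    fix f assume "f \<in> fin_supp_funs R" "m \<cdot>\<^bsub>skew_laurent_module R \<sigma> M\<^esub> f = (\<lambda>i. \<zero>\<^bsub>M\<^esub>)"
    then show "f \<in> {E \<otimes>\<^bsub>skew_laurent_ring R \<sigma>\<^esub> a | a. a \<in> fin_supp_funs R}"
      using fixed by blast
  next
    fix f g assume "f = E \<otimes>\<^bsub>skew_laurent_ring R \<sigma>\<^esub> g" "g \<in> fin_supp_funs R"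
    then show "f \<in> {f \<in> fin_supp_funs R. m \<cdot>\<^bsub>skew_laurent_module R \<sigma> M\<^esub> f = (\<lambda>i. \<zero>\<^bsub>M\<^esub>)}"
      using killed mult_skew_laurent_fin_supp[OF E] by simp
  qed
  then show "\<exists>e\<in>carrier (skew_laurent_ring R \<sigma>). e \<otimes>\<^bsub>skew_laurent_ring R \<sigma>\<^esub> e = e \<and>
      right_annihilator (skew_laurent_ring R \<sigma>) (skew_laurent_module R \<sigma> M) m =
        {e \<otimes>\<^bsub>skew_laurent_ring R \<sigma>\<^esub> a | a. a \<in> carrier (skew_laurent_ring R \<sigma>)}"
    unfolding carr using E idem by blast
qed

lemma pp_module_of_skew_laurent:
  assumes pp: "pp_module (skew_laurent_ring R \<sigma>) (skew_laurent_module R \<sigma> M)"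
  shows "pp_module R M"
  unfolding pp_module_iff
proof
  fix m assume m: "m \<in> carrier M"
  have carr: "carrier (skew_laurent_ring R \<sigma>) = fin_supp_funs R"
    "carrier (skew_laurent_module R \<sigma> M) = fin_supp_funs M"
    "\<zero>\<^bsub>skew_laurent_module R \<sigma> M\<^esub> = (\<lambda>i. \<zero>\<^bsub>M\<^esub>)"
    by (simp_all add: skew_laurent_ring_def skew_laurent_module_def)
  have cm: "(const_coeff M m :: int \<Rightarrow> 'b) \<in> fin_supp_funs M"
    using m by (simp add: const_coeff_fin_supp)
  obtain E where E: "E \<in> fin_supp_funs R" "E \<otimes>\<^bsub>skew_laurent_ring R \<sigma>\<^esub> E = E"
    and ann: "right_annihilator (skew_laurent_ring R \<sigma>) (skew_laurent_module R \<sigma> M) (const_coeff M m) =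
        {E \<otimes>\<^bsub>skew_laurent_ring R \<sigma>\<^esub> a | a. a \<in> fin_supp_funs R}"
    using pp cm unfolding pp_module_def carr by blast
  have E0: "E 0 \<in> carrier R"
    using E by (simp add: fin_supp_funs_def)
  have "E \<in> right_annihilator (skew_laurent_ring R \<sigma>) (skew_laurent_module R \<sigma> M) (const_coeff M m)"
    unfolding ann using E by force
  then have "const_coeff M m \<cdot>\<^bsub>skew_laurent_module R \<sigma> M\<^esub> E = (\<lambda>i. \<zero>\<^bsub>M\<^esub>)"
    by (simp add: right_annihilator_def carr)
  then have mE: "m \<cdot>\<^bsub>M\<^esub> E 0 = \<zero>\<^bsub>M\<^esub>"
    unfolding const_coeff_rsmult_skew_laurent[OF m E(1)] by (simp add: fun_eq_iff)
  \<comment> \<open>Unlike for polynomials, \<open>E E = E\<close> does not by itself make \<open>E 0\<close> idempotent; but \<open>E a = a\<close> on \<open>r(m)\<close>, which contains \<open>E 0\<close>.\<close>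
  have fix_ann: "E 0 \<otimes> a = a" if a: "a \<in> carrier R" and ma: "m \<cdot>\<^bsub>M\<^esub> a = \<zero>\<^bsub>M\<^esub>" for a
  proof -
    have ca: "(const_coeff R a :: int \<Rightarrow> 'a) \<in> fin_supp_funs R"
      using a by (simp add: const_coeff_fin_supp)
    have "const_coeff R a \<in> right_annihilator (skew_laurent_ring R \<sigma>) (skew_laurent_module R \<sigma> M) (const_coeff M m)"
      using m ma ca const_coeff_rsmult_skew_laurent[OF m ca]
      by (auto simp: right_annihilator_def carr const_coeff_def)
    then obtain g where g: "g \<in> fin_supp_funs R" "const_coeff R a = E \<otimes>\<^bsub>skew_laurent_ring R \<sigma>\<^esub> g"
      unfolding ann by blast
    \<comment> \<open>Since the constant \<open>a\<close> equals \<open>E g\<close>, associativity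
      gives \<open>E (E g) = (E E) g = E g\<close>.\<close>
    then have "E \<otimes>\<^bsub>skew_laurent_ring R \<sigma>\<^esub> const_coeff R a = const_coeff R a"
      using mult_skew_laurent_assoc[OF E(1) E(1) g(1)] E(2) by simp
    then have "a = (E \<otimes>\<^bsub>skew_laurent_ring R \<sigma>\<^esub> const_coeff R a) 0"
      by simp
    \<comment> \<open>Index 0 is added in case \<open>E 0\<close> is zero. At exponent 0 every other
      index meets a zero coefficient of the constant \<open>a\<close>, so only \<open>E 0\<close>
      times \<open>a\<close> remains.\<close>
    also have "\<dots> = (\<Oplus>i\<in>insert 0 {i. E i \<noteq> \<zero>}. E i \<otimes> aut_power R \<sigma> i (const_coeff R a (0 - i)))"
      using E(1) by (intro mult_skew_laurent_widen[OF E(1) ca]) (auto simp: fin_supp_funs_def)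
    also have "\<dots> = (\<Oplus>i\<in>{0::int}. E 0 \<otimes> a)"
      using E(1) a by (intro R.add.finprod_mono_neutral_cong_right) (auto simp: const_coeff_def fin_supp_funs_def)
    finally show ?thesis
      using E0 a by simp
  qed
  have "E 0 \<otimes> E 0 = E 0"
    using fix_ann[OF E0 mE] .
  moreover have "m \<cdot>\<^bsub>M\<^esub> a = \<zero>\<^bsub>M\<^esub>" if "a \<in> carrier R" "E 0 \<otimes> a = a" for a
    using that m E0 mE by (metis rsmult_assoc rsmult_zero_left)
  ultimately show "\<exists>e\<in>carrier R. e \<otimes> e = e \<and> (\<forall>a\<in>carrier R. m \<cdot>\<^bsub>M\<^esub> a = \<zero>\<^bsub>M\<^esub> \<longleftrightarrow> e \<otimes> a = a)"
    using E0 fix_ann by blast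
qed

end

theorem proposition3p1:
  fixes R :: "('a, 'r) ring_scheme"
    and M :: "('a, 'b, 'm) right_module_scheme"
    and \<sigma> :: "'a \<Rightarrow> 'a"
  assumes "ring R"
    and "\<sigma> \<in> ring_hom R R"
    and "right_module R M"
    and "skew_Armendariz R \<sigma> M"
    and "condition_C2 R \<sigma> M"
  shows "(pp_module R M \<longleftrightarrow>
            pp_module (skew_poly_ring R \<sigma>) (skew_poly_module R \<sigma> M))
       \<and> (\<sigma> \<in> ring_iso R R \<longrightarrow>
            (pp_module R M \<longleftrightarrow>
               pp_module (skew_laurent_ring R \<sigma>) (skew_laurent_module R \<sigma> M)))"
proof (intro conjI impI)
  interpret skew_Armendariz_module R M \<sigma>
    using assms by (simp add: skew_Armendariz_module_def skew_Armendariz_module_axioms_def)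
  show "pp_module R M \<longleftrightarrow> pp_module (skew_poly_ring R \<sigma>) (skew_poly_module R \<sigma> M)"
    using pp_skew_poly_module pp_module_of_skew_poly assms(5) by blast
  assume "\<sigma> \<in> ring_iso R R"
  then interpret skew_Armendariz_module_aut R M \<sigma>
    by unfold_locales
  show "pp_module R M \<longleftrightarrow> pp_module (skew_laurent_ring R \<sigma>) (skew_laurent_module R \<sigma> M)"
    using pp_skew_laurent_module pp_module_of_skew_laurent assms(5) by blast
qed

end
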